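(* Every model $\mathcal{M}$ of $T^I_\triangleright$ is a model of $I\mathrm{Open}(L_\triangleright)$.
   Context: $L_\triangleright$ is the one-sorted first-order language with function symbols $0$ (constant), $s$, $p$ (unary), $+$ (binary, infix) and a binary predicate symbol $\triangleright$ (infix). $T^I_\triangleright$ is the theory with axioms (A1) $\forall x\, sx\neq 0$; (A2) $p0=0$; (A3) $\forall x\, p\,sx=x$; (A4) $\forall x\, x+0=x$; (A5) $\forall x\forall y\, x+sy=s(x+y)$; (A6) $0\triangleright 0$; (A7) $\forall x\forall y\,(x\triangleright y\to sx\triangleright (sx+y))$; (A8) $\forall x\forall y\,(sx\triangleright(sx+y)\to x\triangleright y)$; (A9) $\forall x\forall y\forall z\,(x\triangleright y\wedge x\triangleright z\to y=z)$; (B1) $\forall x\,(x\neq0\to x=s\,p\,x)$; (B2) $\forall x\forall y\, x+y=y+x$; (B3) $\forall x\forall y\forall z\,(x+y)+z=x+(y+z)$; (B4) $\forall x\forall y\forall z\,(x+y=x+z\to y=z)$. For a formula $\psi(x,\vec z)$, $I_x\psi:=\forall\vec z\,(\psi(0,\vec z)\to\forall x(\psi(x,\vec z)\to\psi(sx,\vec z))\to\forall x\,\psi(x,\vec z))$, and $I\mathrm{Open}(L_\triangleright)$ is the set of all $I_x\psi$ with $\psi$ a quantifier-free $L_\triangleright$ formula. *)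

theory Defs
  imports Main
begin

datatype tm = Var nat | Zero ("\<^bold>0") | Succ tm | Pred tm | Plus tm tm (infixl "\<^bold>+" 65)

datatype fm =
    Eq tm tm (infix "\<^bold>=" 50)
  | Tri tm tm (infix "\<^bold>\<triangleright>" 50)
  | Falsum ("\<^bold>\<bottom>")
  | Neg fm ("\<^bold>\<not> _" [40] 40)
  | And fm fm (infixr "\<^bold>\<and>" 35)
  | Or fm fm (infixr "\<^bold>\<or>" 30)
  | Imp fm fm (infixr "\<^bold>\<longrightarrow>" 25)
  | Forall nat fm ("(\<^bold>\<forall>_./ _)" [0, 10] 10)
  | Exists nat fm ("(\<^bold>\<exists>_./ _)" [0, 10] 10)

abbreviation Neq :: "tm \<Rightarrow> tm \<Rightarrow> fm" (infix "\<^bold>\<noteq>" 50)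
  where "t \<^bold>\<noteq> u \<equiv> \<^bold>\<not> (t \<^bold>= u)"

fun vars_tm :: "tm \<Rightarrow> nat set" where
  "vars_tm (Var v) = {v}"
| "vars_tm \<^bold>0 = {}"
| "vars_tm (Succ t) = vars_tm t"
| "vars_tm (Pred t) = vars_tm t"
| "vars_tm (t \<^bold>+ u) = vars_tm t \<union> vars_tm u"

fun free_vars :: "fm \<Rightarrow> nat set" where
  "free_vars (t \<^bold>= u) = vars_tm t \<union> vars_tm u"
| "free_vars (t \<^bold>\<triangleright> u) = vars_tm t \<union> vars_tm u"
| "free_vars \<^bold>\<bottom> = {}"
| "free_vars (\<^bold>\<not> \<phi>) = free_vars \<phi>"
| "free_vars (\<phi> \<^bold>\<and> \<psi>) = free_vars \<phi> \<union> free_vars \<psi>"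
| "free_vars (\<phi> \<^bold>\<or> \<psi>) = free_vars \<phi> \<union> free_vars \<psi>"
| "free_vars (\<phi> \<^bold>\<longrightarrow> \<psi>) = free_vars \<phi> \<union> free_vars \<psi>"
| "free_vars (\<^bold>\<forall>v. \<phi>) = free_vars \<phi> - {v}"
| "free_vars (\<^bold>\<exists>v. \<phi>) = free_vars \<phi> - {v}"

fun quantifier_free :: "fm \<Rightarrow> bool" where
  "quantifier_free (\<^bold>\<not> \<phi>) = quantifier_free \<phi>"
| "quantifier_free (\<phi> \<^bold>\<and> \<psi>) = (quantifier_free \<phi> \<and> quantifier_free \<psi>)"
| "quantifier_free (\<phi> \<^bold>\<or> \<psi>) = (quantifier_free \<phi> \<and> quantifier_free \<psi>)"
| "quantifier_free (\<phi> \<^bold>\<longrightarrow> \<psi>) = (quantifier_free \<phi> \<and> quantifier_free \<psi>)"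
| "quantifier_free (\<^bold>\<forall>v. \<phi>) = False"
| "quantifier_free (\<^bold>\<exists>v. \<phi>) = False"
| "quantifier_free _ = True"

fun subst_tm :: "nat \<Rightarrow> tm \<Rightarrow> tm \<Rightarrow> tm" where
  "subst_tm x r (Var v) = (if v = x then r else Var v)"
| "subst_tm x r \<^bold>0 = \<^bold>0"
| "subst_tm x r (Succ t) = Succ (subst_tm x r t)"
| "subst_tm x r (Pred t) = Pred (subst_tm x r t)"
| "subst_tm x r (t \<^bold>+ u) = subst_tm x r t \<^bold>+ subst_tm x r u"

text \<open>Bound variables are not renamed. No capture can occur as long as \<open>r\<close> contains no
  variable other than \<open>x\<close>; below, \<open>r\<close> is only ever \<open>\<^bold>0\<close> or \<open>Succ (Var x)\<close>.\<close>

fun subst :: "nat \<Rightarrow> tm \<Rightarrow> fm \<Rightarrow> fm" where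
  "subst x r (t \<^bold>= u) = (subst_tm x r t \<^bold>= subst_tm x r u)"
| "subst x r (t \<^bold>\<triangleright> u) = (subst_tm x r t \<^bold>\<triangleright> subst_tm x r u)"
| "subst x r \<^bold>\<bottom> = \<^bold>\<bottom>"
| "subst x r (\<^bold>\<not> \<phi>) = (\<^bold>\<not> subst x r \<phi>)"
| "subst x r (\<phi> \<^bold>\<and> \<psi>) = (subst x r \<phi> \<^bold>\<and> subst x r \<psi>)"
| "subst x r (\<phi> \<^bold>\<or> \<psi>) = (subst x r \<phi> \<^bold>\<or> subst x r \<psi>)"
| "subst x r (\<phi> \<^bold>\<longrightarrow> \<psi>) = (subst x r \<phi> \<^bold>\<longrightarrow> subst x r \<psi>)"
| "subst x r (\<^bold>\<forall>v. \<phi>) = (if v = x then \<^bold>\<forall>v. \<phi> else \<^bold>\<forall>v. subst x r \<phi>)"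
| "subst x r (\<^bold>\<exists>v. \<phi>) = (if v = x then \<^bold>\<exists>v. \<phi> else \<^bold>\<exists>v. subst x r \<phi>)"

text \<open>The universe of a structure is the type \<open>'a\<close>, which is nonempty like every HOL type.\<close>

record 'a struct =
  zero_of :: 'a
  s_of :: "'a \<Rightarrow> 'a"
  p_of :: "'a \<Rightarrow> 'a"
  plus_of :: "'a \<Rightarrow> 'a \<Rightarrow> 'a"
  tri_of :: "'a \<Rightarrow> 'a \<Rightarrow> bool"

fun eval :: "'a struct \<Rightarrow> (nat \<Rightarrow> 'a) \<Rightarrow> tm \<Rightarrow> 'a" where
  "eval M e (Var v) = e v"
| "eval M e \<^bold>0 = zero_of M"
| "eval M e (Succ t) = s_of M (eval M e t)"
| "eval M e (Pred t) = p_of M (eval M e t)"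
| "eval M e (t \<^bold>+ u) = plus_of M (eval M e t) (eval M e u)"

fun sat :: "'a struct \<Rightarrow> (nat \<Rightarrow> 'a) \<Rightarrow> fm \<Rightarrow> bool" where
  "sat M e (t \<^bold>= u) \<longleftrightarrow> eval M e t = eval M e u"
| "sat M e (t \<^bold>\<triangleright> u) \<longleftrightarrow> tri_of M (eval M e t) (eval M e u)"
| "sat M e \<^bold>\<bottom> \<longleftrightarrow> False"
| "sat M e (\<^bold>\<not> \<phi>) \<longleftrightarrow> \<not> sat M e \<phi>"
| "sat M e (\<phi> \<^bold>\<and> \<psi>) \<longleftrightarrow> sat M e \<phi> \<and> sat M e \<psi>"
| "sat M e (\<phi> \<^bold>\<or> \<psi>) \<longleftrightarrow> sat M e \<phi> \<or> sat M e \<psi>"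
| "sat M e (\<phi> \<^bold>\<longrightarrow> \<psi>) \<longleftrightarrow> (sat M e \<phi> \<longrightarrow> sat M e \<psi>)"
| "sat M e (\<^bold>\<forall>v. \<phi>) \<longleftrightarrow> (\<forall>a. sat M (e(v := a)) \<phi>)"
| "sat M e (\<^bold>\<exists>v. \<phi>) \<longleftrightarrow> (\<exists>a. sat M (e(v := a)) \<phi>)"

text \<open>The two theories below consist of sentences, so the choice of the assignment \<open>e\<close> is
  immaterial for them.\<close>

definition is_model :: "'a struct \<Rightarrow> fm set \<Rightarrow> bool" (infix "\<Turnstile>" 50) where
  "M \<Turnstile> T \<longleftrightarrow> (\<forall>\<phi>\<in>T. \<forall>e. sat M e \<phi>)"

abbreviation (input) "x \<equiv> Var 0"
abbreviation (input) "y \<equiv> Var 1"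
abbreviation (input) "z \<equiv> Var 2"

definition T_I_tri :: "fm set" where
  "T_I_tri = {
    \<^bold>\<forall>0. Succ x \<^bold>\<noteq> \<^bold>0,
    Pred \<^bold>0 \<^bold>= \<^bold>0,
    \<^bold>\<forall>0. Pred (Succ x) \<^bold>= x,
    \<^bold>\<forall>0. x \<^bold>+ \<^bold>0 \<^bold>= x,
    \<^bold>\<forall>0. \<^bold>\<forall>1. x \<^bold>+ Succ y \<^bold>= Succ (x \<^bold>+ y),
    \<^bold>0 \<^bold>\<triangleright> \<^bold>0,
    \<^bold>\<forall>0. \<^bold>\<forall>1. x \<^bold>\<triangleright> y \<^bold>\<longrightarrow> Succ x \<^bold>\<triangleright> (Succ x \<^bold>+ y),
    \<^bold>\<forall>0. \<^bold>\<forall>1. Succ x \<^bold>\<triangleright> (Succ x \<^bold>+ y) \<^bold>\<longrightarrow> x \<^bold>\<triangleright> y,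
    \<^bold>\<forall>0. \<^bold>\<forall>1. \<^bold>\<forall>2. x \<^bold>\<triangleright> y \<^bold>\<and> x \<^bold>\<triangleright> z \<^bold>\<longrightarrow> y \<^bold>= z,
    \<^bold>\<forall>0. x \<^bold>\<noteq> \<^bold>0 \<^bold>\<longrightarrow> x \<^bold>= Succ (Pred x),
    \<^bold>\<forall>0. \<^bold>\<forall>1. x \<^bold>+ y \<^bold>= y \<^bold>+ x,
    \<^bold>\<forall>0. \<^bold>\<forall>1. \<^bold>\<forall>2. (x \<^bold>+ y) \<^bold>+ z \<^bold>= x \<^bold>+ (y \<^bold>+ z),
    \<^bold>\<forall>0. \<^bold>\<forall>1. \<^bold>\<forall>2. x \<^bold>+ y \<^bold>= x \<^bold>+ z \<^bold>\<longrightarrow> y \<^bold>= z}"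

definition Forall_list :: "nat list \<Rightarrow> fm \<Rightarrow> fm" where
  "Forall_list zs \<phi> = foldr Forall zs \<phi>"

definition Ind :: "nat \<Rightarrow> nat list \<Rightarrow> fm \<Rightarrow> fm" where
  "Ind v zs \<psi> =
    Forall_list zs (subst v \<^bold>0 \<psi> \<^bold>\<longrightarrow> (\<^bold>\<forall>v. \<psi> \<^bold>\<longrightarrow> subst v (Succ (Var v)) \<psi>) \<^bold>\<longrightarrow> (\<^bold>\<forall>v. \<psi>))"

text \<open>Writing \<open>\<psi>(x, z\<^sub>1, \<dots>, z\<^sub>n)\<close> presupposes that the listed variables are distinct and include
  all free variables of \<open>\<psi>\<close>.\<close>

definition IOpen :: "fm set" where
  "IOpen = {Ind v zs \<psi> | v zs \<psi>.
     quantifier_free \<psi> \<and> distinct (v # zs) \<and> free_vars \<psi> \<subseteq> set (v # zs)}"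

hide_const (open) x y z

end

theory Submission imports Defs Complex_Main begin

text \<open>
  Let \<open>b\<close> be a nonstandard element. Along the standard numbers \<open>n\<close> and along the descending chain
  \<open>b - n\<close>, for large \<open>n\<close>, every term in the single variable \<open>x\<close> has the shape \<open>k x + c - n'\<close> with
  \<open>k\<close>, \<open>n'\<close> standard. An equation between two such terms of equal slope does not depend on \<open>x\<close>,
  and one between terms of different slope has at most one solution on each chain. The same holds
  for \<open>t \<triangleright> u\<close> if \<open>t\<close> has positive slope, because moving from \<open>x\<close> to \<open>x + m\<close> changes the
  triangular number of \<open>t\<close> by at least \<open>k m t\<close>, which eventually exceeds each given standard multiple
  of \<open>m\<close>. So each open formula is eventually constant, with the same truth value on both chains. If
  it is inductive, it holds on all standard numbers, hence at some \<open>b - n\<close>, hence at \<open>b\<close>.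
\<close>

lemma eventually_false_if_sparse:
  fixes N :: nat
  assumes "\<And>m n. N \<le> m \<Longrightarrow> m < n \<Longrightarrow> Q m \<Longrightarrow> Q n \<Longrightarrow> False"
  shows "\<exists>K. \<forall>n\<ge>K. \<not> Q n"
proof (cases "\<exists>m\<ge>N. Q m")
  case True
  then obtain m where "m \<ge> N" "Q m" by blast
  then have "\<forall>n\<ge>Suc m. \<not> Q n" using assms Suc_le_lessD by blast
  then show ?thesis by blast
qed blast

section \<open>Addition, standard numbers and multiples in a model\<close>

locale triangular_monoid =
  fixes zero :: 'a ("\<zero>")
    and s p :: "'a \<Rightarrow> 'a"
    and add :: "'a \<Rightarrow> 'a \<Rightarrow> 'a" (infixl "\<oplus>" 65)
    and tri :: "'a \<Rightarrow> 'a \<Rightarrow> bool" (infix "\<triangleright>" 50)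
  assumes s_neq_zero [simp]: "s x \<noteq> \<zero>"
    and p_s [simp]: "p (s x) = x"
    and add_zero [simp]: "x \<oplus> \<zero> = x"
    and add_s [simp]: "x \<oplus> s y = s (x \<oplus> y)"
    and tri_step: "x \<triangleright> y \<Longrightarrow> s x \<triangleright> s x \<oplus> y"
    and tri_functional: "x \<triangleright> y \<Longrightarrow> x \<triangleright> z \<Longrightarrow> y = z"
    and s_p: "x \<noteq> \<zero> \<Longrightarrow> x = s (p x)"
    and add_commute: "x \<oplus> y = y \<oplus> x"
    and add_assoc: "(x \<oplus> y) \<oplus> z = x \<oplus> (y \<oplus> z)"
    and add_cancel: "x \<oplus> y = x \<oplus> z \<Longrightarrow> y = z"
begin

lemma add_left_commute: "x \<oplus> (y \<oplus> z) = y \<oplus> (x \<oplus> z)"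
  by (metis add_assoc add_commute)

lemmas add_ac = add_assoc add_commute add_left_commute

lemma zero_add [simp]: "\<zero> \<oplus> x = x"
  by (metis add_commute add_zero)

lemma s_add [simp]: "s x \<oplus> y = s (x \<oplus> y)"
  by (metis add_commute add_s)

lemma s_inject [simp]: "s x = s y \<longleftrightarrow> x = y"
  by (metis p_s)

lemma add_left_cancel [simp]: "x \<oplus> y = x \<oplus> z \<longleftrightarrow> y = z"
  using add_cancel by blast

lemma add_right_cancel [simp]: "y \<oplus> x = z \<oplus> x \<longleftrightarrow> y = z"
  by (metis add_commute add_left_cancel)

primrec num :: "nat \<Rightarrow> 'a" where
  "num 0 = \<zero>"
| "num (Suc n) = s (num n)"

primrec multiple :: "nat \<Rightarrow> 'a \<Rightarrow> 'a" where
  "multiple 0 x = \<zero>"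
| "multiple (Suc k) x = x \<oplus> multiple k x"

lemma num_add: "num (m + n) = num m \<oplus> num n"
  by (induction m) auto

lemma num_inject [simp]: "num m = num n \<longleftrightarrow> m = n"
proof (induction m arbitrary: n)
  case 0
  show ?case by (cases n) (auto dest: sym)
next
  case (Suc m)
  then show ?case by (cases n) auto
qed

lemma multiple_add_left: "multiple (k + l) x = multiple k x \<oplus> multiple l x"
  by (induction k) (auto simp: add_assoc)

lemma multiple_add_right: "multiple k (x \<oplus> y) = multiple k x \<oplus> multiple k y"
  by (induction k) (auto simp: add_ac)

lemma multiple_num: "multiple k (num m) = num (k * m)"
  by (induction k) (auto simp: num_add)

text \<open>As long as \<open>x\<close> is not zero, \<open>s_p\<close> lets one successor be
  cancelled on both sides, at most \<open>j\<close> times. So the standard numbers form an initial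
  segment.\<close>

lemma add_eq_num:
  assumes "x \<oplus> w = num j"
  shows "\<exists>i\<le>j. x = num i"
  using assms
proof (induction j arbitrary: x)
  case 0
  have "x = \<zero>"
  proof (rule ccontr)
    assume "x \<noteq> \<zero>"
    then have "x \<oplus> w = s (p x \<oplus> w)" using s_p s_add by metis
    with 0 show False by simp
  qed
  then show ?case by simp
next
  case (Suc j)
  show ?case
  proof (cases "x = \<zero>")
    case True
    then show ?thesis by (intro exI[of _ 0]) simp
  next
    case False
    then have x: "x = s (p x)" by (rule s_p)
    then have "s (p x \<oplus> w) = s (num j)" using Suc.prems by (metis s_add num.simps(2))
    then obtain i where "i \<le> j" "p x = num i" using Suc.IH by auto
    then show ?thesis using x by (intro exI[of _ "Suc i"]) simp
  qed
qed

text \<open>Iterating \<open>tri_step\<close> adds \<open>a + 1\<close>, ..., \<open>a + m\<close>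
  to \<open>u\<close>. Of this sum, \<open>m a\<close> gives the growth rate and
  \<open>1 + ... + m\<close> goes into \<open>w\<close>.\<close>

lemma tri_add_num:
  assumes "a \<triangleright> u"
  shows "\<exists>w. a \<oplus> num m \<triangleright> u \<oplus> (multiple m a \<oplus> w)"
proof (induction m)
  case 0
  show ?case using assms by (intro exI[of _ \<zero>]) simp
next
  case (Suc m)
  then obtain w where "a \<oplus> num m \<triangleright> u \<oplus> (multiple m a \<oplus> w)" by blast
  from tri_step[OF this]
  have "a \<oplus> num (Suc m) \<triangleright> s (a \<oplus> num m) \<oplus> (u \<oplus> (multiple m a \<oplus> w))" by simp
  also have "s (a \<oplus> num m) \<oplus> (u \<oplus> (multiple m a \<oplus> w)) =
      u \<oplus> (multiple (Suc m) a \<oplus> (s (num m) \<oplus> w))"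
    by (simp add: add_ac)
  finally show ?case by blast
qed

text \<open>By functionality, the growth \<open>k m a + w\<close> of the triangular numbers would
  equal \<open>l m\<close>. Then \<open>a\<close> is a standard \<open>j\<close> with
  \<open>k j m \<le> l m\<close>, so \<open>j \<le> l\<close>, against \<open>large\<close>. With
  slopes \<open>k\<close> and \<open>l\<close> this rules out two solutions at distance
  \<open>m\<close>.\<close>

lemma no_two_tri:
  assumes "a \<triangleright> u" "a \<oplus> num (k * m) \<triangleright> u \<oplus> num (l * m)"
    and "k > 0" "m > 0" and large: "\<And>j. a = num j \<Longrightarrow> l < j"
  shows False
proof -
  obtain w where "a \<oplus> num (k * m) \<triangleright> u \<oplus> (multiple (k * m) a \<oplus> w)"
    using tri_add_num[OF assms(1)] by blast
  then have eq: "multiple (k * m) a \<oplus> w = num (l * m)"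
    using tri_functional[OF assms(2)] add_cancel by metis
  obtain r where "k * m = Suc r" using assms(3,4) gr0_implies_Suc nat_0_less_mult_iff by metis
  then have "a \<oplus> (multiple r a \<oplus> w) = num (l * m)" using eq by (simp add: add_assoc)
  then obtain j where j: "a = num j" using add_eq_num by blast
  obtain i where "i \<le> l * m" "num (k * m * j) = num i"
    using add_eq_num[OF eq] unfolding j multiple_num by blast
  then have "k * j * m \<le> l * m" by (simp add: mult.commute mult.left_commute)
  then have "k * j \<le> l" using \<open>m > 0\<close> by simp
  moreover have "j \<le> k * j" using \<open>k > 0\<close> by simp
  ultimately show False using large[OF j] by linarith
qed

text \<open>Stands for \<open>f x = k x + c - n\<close>, with the subtraction moved to the left
  side. Here \<open>c\<close> is any element of the model, while \<open>k\<close> and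
  \<open>n\<close> are standard.\<close>

definition affine_at :: "('a \<Rightarrow> 'a) \<Rightarrow> nat \<Rightarrow> nat \<Rightarrow> 'a \<Rightarrow> 'a \<Rightarrow> bool" where
  "affine_at f k n c x \<longleftrightarrow> f x \<oplus> num n = multiple k x \<oplus> c"

lemma affine_at_step:
  assumes "affine_at f k n c x" "affine_at f k n c (x \<oplus> num m)"
  shows "f (x \<oplus> num m) = f x \<oplus> num (k * m)"
proof -
  have "f (x \<oplus> num m) \<oplus> num n = multiple k x \<oplus> num (k * m) \<oplus> c"
    using assms(2) by (simp add: affine_at_def multiple_add_right multiple_num)
  also have "\<dots> = f x \<oplus> num n \<oplus> num (k * m)"
    using assms(1) by (simp add: affine_at_def add_ac)
  also have "\<dots> = f x \<oplus> num (k * m) \<oplus> num n" by (simp add: add_ac)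
  finally show ?thesis by simp
qed

text \<open>The supremum of filters makes "eventually" refer to both chains at once, so an eventual
  truth value is shared by them.\<close>

definition ends :: "'a \<Rightarrow> 'a filter" where
  "ends b = sup (filtermap num sequentially) (filtermap (\<lambda>n. (p ^^ n) b) sequentially)"

lemma eventually_ends:
  "eventually P (ends b) \<longleftrightarrow> (\<exists>N. \<forall>n\<ge>N. P (num n) \<and> P ((p ^^ n) b))"
proof -
  have "eventually P (ends b) \<longleftrightarrow>
      eventually (\<lambda>n. P (num n) \<and> P ((p ^^ n) b)) sequentially"
    by (simp add: ends_def eventually_sup eventually_filtermap eventually_conj_iff)
  then show ?thesis by (simp add: eventually_sequentially)
qed

lemma ends_neq_bot: "ends b \<noteq> bot"
  by (auto simp: trivial_limit_def eventually_ends)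

section \<open>Limits along the standard numbers and a descending nonstandard chain\<close>

context
  fixes b
  assumes nonstandard: "b \<noteq> num n"
begin

text \<open>If an iterate were zero, \<open>b\<close> would equal \<open>num n\<close>. So each
  \<open>p\<close> on the chain undoes a successor.\<close>

lemma p_power_add: "(p ^^ n) b \<oplus> num n = b"
proof (induction n)
  case (Suc n)
  have "(p ^^ n) b \<noteq> \<zero>" using Suc nonstandard by (metis zero_add)
  then have "s ((p ^^ Suc n) b) = (p ^^ n) b" using s_p by simp
  then have "(p ^^ Suc n) b \<oplus> num (Suc n) = (p ^^ n) b \<oplus> num n"
    by (metis add_s s_add num.simps(2))
  then show ?case using Suc by simp
qed simp

lemma p_power_diff:
  assumes "m \<le> n"
  shows "(p ^^ m) b = (p ^^ n) b \<oplus> num (n - m)"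
proof -
  have "(p ^^ n) b \<oplus> num (n - m) \<oplus> num m = (p ^^ m) b \<oplus> num m"
    using assms p_power_add by (simp add: add_assoc flip: num_add)
  then show ?thesis by simp
qed

text \<open>On the standard chain this is \<open>add_eq_num\<close>; on the other one the premise
  would make \<open>b\<close> standard. The summand \<open>w\<close> prepares for values
  \<open>k x + c\<close>, from which one \<open>x\<close> is split off.\<close>

lemma eventually_large: "eventually (\<lambda>x. \<forall>w j. x \<oplus> w = num j \<longrightarrow> J < j) (ends b)"
  unfolding eventually_ends
proof (intro exI[of _ "Suc J"] allI impI conjI)
  fix n w j
  assume "n \<ge> Suc J" "num n \<oplus> w = num j"
  then show "J < j" using add_eq_num by fastforce
next
  fix n w j
  assume "(p ^^ n) b \<oplus> w = num j"
  then obtain i where "(p ^^ n) b = num i" using add_eq_num by blast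
  then have "b = num (i + n)" using p_power_add[of n] by (simp add: num_add)
  then show "J < j" using nonstandard by blast
qed

text \<open>The larger of two points comes later among the standard numbers but earlier on the
  descending chain. Either way it is \<open>x + m\<close> for the smaller point \<open>x\<close>, so
  one hypothesis serves both chains.\<close>

lemma eventually_not_if_sparse:
  assumes "eventually G (ends b)"
    and sparse: "\<And>x m. m > 0 \<Longrightarrow> G x \<Longrightarrow> G (x \<oplus> num m) \<Longrightarrow> P x \<Longrightarrow> P (x \<oplus> num m) \<Longrightarrow> False"
  shows "eventually (\<lambda>x. \<not> P x) (ends b)"
proof -
  obtain N where N: "\<And>n. n \<ge> N \<Longrightarrow> G (num n)" "\<And>n. n \<ge> N \<Longrightarrow> G ((p ^^ n) b)"
    using assms(1) by (auto simp: eventually_ends)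
  have up: False if "m \<ge> N" "m < n" "P (num m)" "P (num n)" for m n
    using sparse[of "n - m" "num m"] N that by (simp flip: num_add)
  have down: False if "m \<ge> N" "m < n" "P ((p ^^ m) b)" "P ((p ^^ n) b)" for m n
    using sparse[of "n - m" "(p ^^ n) b"] N that by (simp flip: p_power_diff)
  have "\<exists>K. \<forall>n\<ge>K. \<not> P (num n)"
    using up by (rule eventually_false_if_sparse)
  moreover have "\<exists>K. \<forall>n\<ge>K. \<not> P ((p ^^ n) b)"
    using down by (rule eventually_false_if_sparse)
  ultimately show ?thesis
    unfolding eventually_ends by (meson le_trans nat_le_linear)
qed

text \<open>The same \<open>k\<close>, \<open>n\<close> and \<open>c\<close> must serve both chains,
  which makes truth values on them comparable.\<close>

definition asymp_affine :: "('a \<Rightarrow> 'a) \<Rightarrow> bool" where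
  "asymp_affine f \<longleftrightarrow> (\<exists>k n c. eventually (affine_at f k n c) (ends b))"

lemma eventually_const_if_slope_zero:
  assumes "eventually (affine_at f 0 n c) (ends b)"
  obtains d where "eventually (\<lambda>x. f x = d) (ends b)"
proof -
  \<comment> \<open>In the absence of a subtraction \<open>c - n\<close>, the constant is the value
    at some point where the equation holds; \<open>ends_neq_bot\<close> supplies one.\<close>
  obtain x0 where x0: "affine_at f 0 n c x0"
    using eventually_happens[OF assms] ends_neq_bot by blast
  have "eventually (\<lambda>x. f x = f x0) (ends b)"
    using assms
  proof eventually_elim
    case (elim x)
    then have "f x \<oplus> num n = f x0 \<oplus> num n" using x0 by (simp add: affine_at_def)
    then show ?case by simp
  qed
  then show ?thesis by (rule that)
qed

lemma eventually_image_large: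
  assumes "eventually (affine_at f k n c) (ends b)" "k > 0"
  shows "eventually (\<lambda>x. \<forall>j. f x = num j \<longrightarrow> J < j) (ends b)"
  \<comment> \<open>The bound is raised by \<open>n\<close> because \<open>f x = num j\<close> leads
    to a sum \<open>x + w = num (j + n)\<close>.\<close>
  using assms(1) eventually_large[of "J + n"]
proof eventually_elim
  case (elim x)
  show ?case
  proof (intro allI impI)
    fix j
    assume "f x = num j"
    moreover obtain r where "k = Suc r" using \<open>k > 0\<close> gr0_implies_Suc by blast
    ultimately have "x \<oplus> (multiple r x \<oplus> c) = num (j + n)"
      using elim(1) by (simp add: affine_at_def num_add add_assoc)
    then show "J < j" using elim(2) by fastforce
  qed
qed

section \<open>Closure of asymptotically affine functions under the operations\<close>

lemma asymp_affine_ident: "asymp_affine (\<lambda>x. x)"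
  unfolding asymp_affine_def affine_at_def
  by (intro exI[of _ 1] exI[of _ 0] exI[of _ \<zero>]) simp

lemma asymp_affine_eventually_const:
  "eventually (\<lambda>x. f x = c) (ends b) \<Longrightarrow> asymp_affine f"
  unfolding asymp_affine_def affine_at_def
  by (intro exI[of _ 0] exI[of _ 0] exI[of _ c]) simp

lemma asymp_affine_const: "asymp_affine (\<lambda>_. c)"
  by (rule asymp_affine_eventually_const[of _ c]) simp

lemma asymp_affine_s:
  assumes "asymp_affine f"
  shows "asymp_affine (\<lambda>x. s (f x))"
proof -
  obtain k n c where "eventually (affine_at f k n c) (ends b)"
    using assms by (auto simp: asymp_affine_def)
  then have "eventually (affine_at (\<lambda>x. s (f x)) k n (s c)) (ends b)"
    by eventually_elim (simp add: affine_at_def)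
  then show ?thesis unfolding asymp_affine_def by blast
qed

lemma asymp_affine_add:
  assumes "asymp_affine f" "asymp_affine g"
  shows "asymp_affine (\<lambda>x. f x \<oplus> g x)"
proof -
  obtain k n c where f: "eventually (affine_at f k n c) (ends b)"
    using assms(1) by (auto simp: asymp_affine_def)
  obtain l m d where g: "eventually (affine_at g l m d) (ends b)"
    using assms(2) by (auto simp: asymp_affine_def)
  from f g have "eventually (affine_at (\<lambda>x. f x \<oplus> g x) (k + l) (n + m) (c \<oplus> d)) (ends b)"
  proof eventually_elim
    case (elim x)
    have "f x \<oplus> g x \<oplus> num (n + m) = (f x \<oplus> num n) \<oplus> (g x \<oplus> num m)"
      by (simp add: num_add add_ac)
    also have "\<dots> = multiple (k + l) x \<oplus> (c \<oplus> d)"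
      using elim by (simp add: affine_at_def multiple_add_left add_ac)
    finally show ?case by (simp add: affine_at_def)
  qed
  then show ?thesis unfolding asymp_affine_def by blast
qed

text \<open>Only the value of \<open>p\<close> at zero could break the affine shape. For slope zero
  the function is eventually constant; for positive slope it eventually avoids zero, and
  \<open>p\<close> raises the offset \<open>n\<close> by one.\<close>

lemma asymp_affine_p:
  assumes "asymp_affine f"
  shows "asymp_affine (\<lambda>x. p (f x))"
proof -
  obtain k n c where f: "eventually (affine_at f k n c) (ends b)"
    using assms by (auto simp: asymp_affine_def)
  show ?thesis
  proof (cases "k = 0")
    case True
    with f obtain d where "eventually (\<lambda>x. f x = d) (ends b)"
      using eventually_const_if_slope_zero by blast
    then have "eventually (\<lambda>x. p (f x) = p d) (ends b)" by eventually_elim simp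
    then show ?thesis by (rule asymp_affine_eventually_const)
  next
    case False
    then have "eventually (\<lambda>x. \<forall>j. f x = num j \<longrightarrow> 0 < j) (ends b)"
      using eventually_image_large[OF f] by blast
    with f have "eventually (affine_at (\<lambda>x. p (f x)) k (Suc n) c) (ends b)"
    proof eventually_elim
      case (elim x)
      have "f x \<noteq> \<zero>" using elim(2) by (metis num.simps(1) less_irrefl)
      then have "p (f x) \<oplus> num (Suc n) = f x \<oplus> num n"
        by (metis s_p add_s s_add num.simps(2))
      then show ?case using elim(1) by (simp add: affine_at_def)
    qed
    then show ?thesis unfolding asymp_affine_def by blast
  qed
qed

section \<open>Predicates with the same eventual truth value on both chains\<close>

definition decided :: "('a \<Rightarrow> bool) \<Rightarrow> bool" where
  "decided P \<longleftrightarrow> eventually P (ends b) \<or> eventually (\<lambda>x. \<not> P x) (ends b)"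

lemma decided_if_eventually_iff:
  "eventually (\<lambda>x. P x \<longleftrightarrow> Q) (ends b) \<Longrightarrow> decided P"
  by (cases Q) (simp_all add: decided_def)

lemma decided_not: "decided P \<Longrightarrow> decided (\<lambda>x. \<not> P x)"
  by (auto simp: decided_def)

lemma decided_conj:
  assumes "decided P" "decided Q"
  shows "decided (\<lambda>x. P x \<and> Q x)"
proof (cases "eventually P (ends b) \<and> eventually Q (ends b)")
  case True
  then show ?thesis by (simp add: decided_def eventually_conj)
next
  case False
  then have "eventually (\<lambda>x. \<not> P x) (ends b) \<or> eventually (\<lambda>x. \<not> Q x) (ends b)"
    using assms by (auto simp: decided_def)
  then have "eventually (\<lambda>x. \<not> (P x \<and> Q x)) (ends b)"
    by (auto elim: eventually_mono)
  then show ?thesis by (simp add: decided_def)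
qed

lemma decided_eq:
  assumes "asymp_affine f" "asymp_affine g"
  shows "decided (\<lambda>x. f x = g x)"
proof -
  obtain k n c where f: "eventually (affine_at f k n c) (ends b)"
    using assms(1) by (auto simp: asymp_affine_def)
  obtain l m d where g: "eventually (affine_at g l m d) (ends b)"
    using assms(2) by (auto simp: asymp_affine_def)
  show ?thesis
  proof (cases "k = l")
    case True
    \<comment> \<open>Adding \<open>n + m\<close> to both sides clears both subtractions, and the
      common multiple of \<open>x\<close> cancels.\<close>
    from f g have "eventually (\<lambda>x. f x = g x \<longleftrightarrow> c \<oplus> num m = d \<oplus> num n) (ends b)"
    proof eventually_elim
      case (elim x)
      have "f x \<oplus> (num n \<oplus> num m) = multiple k x \<oplus> (c \<oplus> num m)"
        using elim(1) by (simp add: affine_at_def flip: add_assoc)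
      moreover have "g x \<oplus> (num n \<oplus> num m) = multiple k x \<oplus> (d \<oplus> num n)"
        using elim(2) True unfolding affine_at_def
        by (metis add_assoc add_commute[of "num n" "num m"])
      ultimately show ?case by (metis add_left_cancel add_right_cancel)
    qed
    then show ?thesis by (rule decided_if_eventually_iff)
  next
    case False
    have "eventually (\<lambda>x. \<not> f x = g x) (ends b)"
      using eventually_conj[OF f g]
    proof (rule eventually_not_if_sparse)
      fix x i
      assume "i > 0" and x: "affine_at f k n c x \<and> affine_at g l m d x"
        and y: "affine_at f k n c (x \<oplus> num i) \<and> affine_at g l m d (x \<oplus> num i)"
        and "f x = g x" "f (x \<oplus> num i) = g (x \<oplus> num i)"
      then have "num (k * i) = num (l * i)"
        using affine_at_step[of f k n c x i] affine_at_step[of g l m d x i] by simp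
      then show False using False \<open>i > 0\<close> by simp
    qed
    then show ?thesis by (simp add: decided_def)
  qed
qed

text \<open>If \<open>f\<close> is eventually constant, functionality allows it at most one partner,
  while a \<open>g\<close> of positive slope keeps changing. If \<open>f\<close> has positive slope,
  \<open>no_two_tri\<close> excludes two solutions.\<close>

lemma decided_tri:
  assumes "asymp_affine f" "asymp_affine g"
  shows "decided (\<lambda>x. f x \<triangleright> g x)"
proof -
  obtain k n c where f: "eventually (affine_at f k n c) (ends b)"
    using assms(1) by (auto simp: asymp_affine_def)
  obtain l m d where g: "eventually (affine_at g l m d) (ends b)"
    using assms(2) by (auto simp: asymp_affine_def)
  consider "k = 0" "l = 0" | "k = 0" "l > 0" | "k > 0" by blast
  then show ?thesis
  proof cases
    case 1
    obtain u v where "eventually (\<lambda>x. f x = u) (ends b)" "eventually (\<lambda>x. g x = v) (ends b)"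
      using eventually_const_if_slope_zero f g 1 by metis
    then have "eventually (\<lambda>x. f x \<triangleright> g x \<longleftrightarrow> u \<triangleright> v) (ends b)" by eventually_elim simp
    then show ?thesis by (rule decided_if_eventually_iff)
  next
    case 2
    have "eventually (\<lambda>x. \<not> f x \<triangleright> g x) (ends b)"
      using eventually_conj[OF f g]
    proof (rule eventually_not_if_sparse)
      fix x i
      assume "i > 0" and x: "affine_at f k n c x \<and> affine_at g l m d x"
        and y: "affine_at f k n c (x \<oplus> num i) \<and> affine_at g l m d (x \<oplus> num i)"
        and tri: "f x \<triangleright> g x" "f (x \<oplus> num i) \<triangleright> g (x \<oplus> num i)"
      then have "f x \<triangleright> g x \<oplus> num (l * i)"
        using affine_at_step[of f k n c x i] affine_at_step[of g l m d x i] 2 by simp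
      then have "g x = g x \<oplus> num (l * i)" by (rule tri_functional[OF tri(1)])
      then have "g x \<oplus> num 0 = g x \<oplus> num (l * i)" by simp
      then have "l * i = 0" unfolding add_left_cancel num_inject by simp
      then show False using 2 \<open>i > 0\<close> by simp
    qed
    then show ?thesis by (simp add: decided_def)
  next
    case 3
    have "eventually (\<lambda>x. \<not> f x \<triangleright> g x) (ends b)"
      \<comment> \<open>The slope \<open>l\<close> of \<open>g\<close> is the threshold that
        \<open>no_two_tri\<close> demands of standard values of \<open>f\<close>.\<close>
      using eventually_conj[OF eventually_conj[OF f g] eventually_image_large[OF f 3, of l]]
    proof (rule eventually_not_if_sparse)
      fix x i
      assume "i > 0"
        and x: "(affine_at f k n c x \<and> affine_at g l m d x) \<and> (\<forall>j. f x = num j \<longrightarrow> l < j)"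
        and y: "(affine_at f k n c (x \<oplus> num i) \<and> affine_at g l m d (x \<oplus> num i)) \<and>
          (\<forall>j. f (x \<oplus> num i) = num j \<longrightarrow> l < j)"
        and tri: "f x \<triangleright> g x" "f (x \<oplus> num i) \<triangleright> g (x \<oplus> num i)"
      then have "f x \<oplus> num (k * i) \<triangleright> g x \<oplus> num (l * i)"
        using affine_at_step[of f k n c x i] affine_at_step[of g l m d x i] by simp
      then show False using no_two_tri[OF tri(1)] 3 \<open>i > 0\<close> x by blast
    qed
    then show ?thesis by (simp add: decided_def)
  qed
qed

end

lemma induct_if_decided:
  assumes decided: "(\<And>n. b \<noteq> num n) \<Longrightarrow> decided b P"
    and zero: "P \<zero>" and step: "\<And>a. P a \<Longrightarrow> P (s a)"
  shows "P b"
proof -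
  have add_num: "P a \<Longrightarrow> P (a \<oplus> num n)" for a n
    by (induction n) (auto intro: step)
  have std: "P (num n)" for n
    using add_num[OF zero, of n] by simp
  show ?thesis
  proof (cases "\<exists>n. b = num n")
    case True
    then show ?thesis using std by auto
  next
    case False
    then have ns: "b \<noteq> num n" for n by blast
    \<comment> \<open>\<open>P\<close> holds on the whole standard chain, so it cannot be eventually
      false; being decided, it also holds far down the other chain.\<close>
    have "\<not> eventually (\<lambda>x. \<not> P x) (ends b)"
      using std by (auto simp: eventually_ends)
    then have "eventually P (ends b)" using decided[OF ns] ns by (auto simp: decided_def)
    then obtain n where "P ((p ^^ n) b)" by (auto simp: eventually_ends)
    then have "P ((p ^^ n) b \<oplus> num n)" by (rule add_num)
    then show ?thesis using p_power_add[OF ns] by simp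
  qed
qed

end

section \<open>From open formulas to predicates of one variable\<close>

lemma eval_subst_tm: "eval M e (subst_tm v r t) = eval M (e(v := eval M e r)) t"
  by (induction t) auto

lemma sat_subst:
  "quantifier_free \<psi> \<Longrightarrow> sat M e (subst v r \<psi>) \<longleftrightarrow> sat M (e(v := eval M e r)) \<psi>"
  by (induction \<psi>) (auto simp: eval_subst_tm)

lemma sat_Forall_list: "(\<And>e. sat M e \<phi>) \<Longrightarrow> sat M e (Forall_list zs \<phi>)"
  by (induction zs arbitrary: e) (auto simp: Forall_list_def)

lemma triangular_monoid_if_model:
  assumes "M \<Turnstile> T_I_tri"
  shows "triangular_monoid (zero_of M) (s_of M) (p_of M) (plus_of M) (tri_of M)"
proof -
  \<comment> \<open>\<open>imp_conjL\<close> curries the premise of the functionality axiom to match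
    \<open>tri_functional\<close>.\<close>
  note axioms = assms[unfolded is_model_def T_I_tri_def, simplified, unfolded imp_conjL]
  show ?thesis
    unfolding triangular_monoid_def by (insert axioms, elim conjE, intro conjI; assumption)
qed

context
  fixes M :: "'a struct" and b :: 'a
  assumes model: "M \<Turnstile> T_I_tri"
begin

interpretation triangular_monoid "zero_of M" "s_of M" "p_of M" "plus_of M" "tri_of M"
  using model by (rule triangular_monoid_if_model)

text \<open>Variables other than \<open>v\<close> are parameters and act as constants, possibly
  nonstandard; the free choice of \<open>c\<close> in \<open>affine_at\<close> accommodates
  them.\<close>

lemma asymp_affine_eval:
  assumes "\<And>n. b \<noteq> num n"
  shows "asymp_affine b (\<lambda>a. eval M (e(v := a)) t)"
proof (induction t)
  case (Var w)
  then show ?case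
    using assms by (cases "w = v") (simp_all add: asymp_affine_ident asymp_affine_const)
qed (simp_all add: assms asymp_affine_const asymp_affine_s asymp_affine_p asymp_affine_add)

lemma decided_sat:
  assumes "\<And>n. b \<noteq> num n" "quantifier_free \<psi>"
  shows "decided b (\<lambda>a. sat M (e(v := a)) \<psi>)"
  using assms(2)
proof (induction \<psi>)
  case (Eq t u)
  show ?case unfolding sat.simps by (intro decided_eq asymp_affine_eval assms(1))
next
  case (Tri t u)
  show ?case unfolding sat.simps by (intro decided_tri asymp_affine_eval assms(1))
next
  case Falsum
  show ?case using assms(1) by (simp add: decided_def)
next
  case (Neg \<phi>)
  then show ?case using assms(1) by (simp add: decided_not)
next
  case (And \<phi> \<chi>)
  then show ?case using assms(1) by (simp add: decided_conj)
next
  case (Or \<phi> \<chi>)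
  \<comment> \<open>Disjunction and, below, implication are reduced to negation and
    conjunction.\<close>
  then have "decided b (\<lambda>a. \<not> (\<not> sat M (e(v := a)) \<phi> \<and> \<not> sat M (e(v := a)) \<chi>))"
    using assms(1) by (intro decided_not decided_conj) (simp_all del: fun_upd_apply)
  then show ?case by (simp del: fun_upd_apply)
next
  case (Imp \<phi> \<chi>)
  then have "decided b (\<lambda>a. \<not> (sat M (e(v := a)) \<phi> \<and> \<not> sat M (e(v := a)) \<chi>))"
    using assms(1) by (intro decided_not decided_conj) (simp_all del: fun_upd_apply)
  then show ?case by (simp del: fun_upd_apply)
qed auto

lemma open_induct:
  assumes "quantifier_free \<psi>" "sat M (e(v := zero_of M)) \<psi>"
    and "\<And>a. sat M (e(v := a)) \<psi> \<Longrightarrow> sat M (e(v := s_of M a)) \<psi>"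
  shows "sat M (e(v := b)) \<psi>"
  using induct_if_decided[of b "\<lambda>a. sat M (e(v := a)) \<psi>"] decided_sat assms by blast

end

theorem theorem3p10:
  fixes M :: "'a struct"
  assumes "M \<Turnstile> T_I_tri"
  shows "M \<Turnstile> IOpen"
  unfolding is_model_def
proof (intro ballI allI)
  fix \<phi> e
  assume "\<phi> \<in> IOpen"
  then obtain v zs \<psi> where \<phi>: "\<phi> = Ind v zs \<psi>" and qf: "quantifier_free \<psi>"
    by (auto simp: IOpen_def)
  show "sat M e \<phi>"
    unfolding \<phi> Ind_def
  proof (rule sat_Forall_list)
    fix e
    show "sat M e (subst v \<^bold>0 \<psi> \<^bold>\<longrightarrow>
        (\<^bold>\<forall>v. \<psi> \<^bold>\<longrightarrow> subst v (Succ (Var v)) \<psi>) \<^bold>\<longrightarrow> (\<^bold>\<forall>v. \<psi>))"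
      using open_induct[OF assms qf] by (simp add: sat_subst[OF qf])
  qed
qed

end
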